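(* For every integer $n\ge0$ and every $\beta\in\mathbb{C}$, with $G_n^{\beta}=U_nE^{n\beta}U_n^{-1}$ (a linear map on polynomials of degree at most $n$), one has $$G_n^{-\beta}=J_nG_n^{\beta}J_n .$$
   Context: Polynomials over $\mathbb{C}$. $U_n$ is the linear map on polynomials of degree at most $n$ with $U_nx^p=\frac{(1-x)^{n+1}}{n!}\sum_{m\ge0}m^px^m$ ($0^0=1$), inverse $U_n^{-1}x^p=(x)_p[x+1]_{n-p}$, where $(y)_p=y(y-1)\cdots(y-p+1)$, $[y]_k=y(y+1)\cdots(y+k-1)$. $E^{\gamma}$ is the shift $c(x)\mapsto c(x+\gamma)$. $J_nc(x)=x^nc(1/x)$. *)

theory Defs
  imports Complex_Main "HOL-Computational_Algebra.Computational_Algebra"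
begin

definition U_series :: "nat \<Rightarrow> nat \<Rightarrow> complex fps" where
  "U_series n p =
     fps_const (1 / fact n) * (1 - fps_X) ^ (n + 1) * Abs_fps (\<lambda>m. of_nat m ^ p)"

text \<open>
  For \<open>p \<le> n\<close> the formal power series above is a polynomial of degree at most \<open>n\<close>
  (\<open>fps_of_poly_U_mono\<close>, \<open>degree_U_mono\<close> below), so the description is legitimate.
\<close>

definition U_mono :: "nat \<Rightarrow> nat \<Rightarrow> complex poly" where
  "U_mono n p = (THE q. fps_of_poly q = U_series n p)"

definition U :: "nat \<Rightarrow> complex poly \<Rightarrow> complex poly" where
  "U n c = (\<Sum>p\<le>n. smult (coeff c p) (U_mono n p))"

abbreviation polys_upto :: "nat \<Rightarrow> complex poly set" where
  "polys_upto n \<equiv> {c. degree c \<le> n}"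

text \<open>
  The inverse is that of \<open>U n\<close> as a self-map of \<open>polys_upto n\<close>; it exists by
  \<open>bij_betw_U\<close>, and \<open>U_inv_monom\<close> gives its values on monomials.
\<close>

definition U_inv :: "nat \<Rightarrow> complex poly \<Rightarrow> complex poly" where
  "U_inv n = inv_into (polys_upto n) (U n)"

definition shift :: "complex \<Rightarrow> complex poly \<Rightarrow> complex poly" where
  "shift \<gamma> c = pcompose c [:\<gamma>, 1:]"

definition G :: "nat \<Rightarrow> complex \<Rightarrow> complex poly \<Rightarrow> complex poly" where
  "G n \<beta> = U n \<circ> shift (of_nat n * \<beta>) \<circ> U_inv n"

text \<open>
  \<open>J n c\<close> is \<open>x\<^sup>n c(1/x)\<close> for \<open>degree c \<le> n\<close>, see \<open>poly_J\<close>.  It differs from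
  \<open>reflect_poly\<close>, which uses the actual degree of \<open>c\<close> in place of \<open>n\<close>.
\<close>

definition J :: "nat \<Rightarrow> complex poly \<Rightarrow> complex poly" where
  "J n c = (\<Sum>k\<le>n. monom (coeff c k) (n - k))"

lemma poly_eq_sum_upto:
  fixes c :: "complex poly"
  assumes "degree c \<le> n"
  shows "poly c x = (\<Sum>k\<le>n. coeff c k * x ^ k)"
proof -
  have "poly c x = poly (\<Sum>k\<le>n. monom (coeff c k) k) x"
    using assms by (simp add: poly_as_sum_of_monoms')
  then show ?thesis by (simp add: poly_sum poly_monom)
qed

lemma poly_J:
  assumes "degree c \<le> n" "x \<noteq> 0"
  shows "poly (J n c) x = x ^ n * poly c (1 / x)"
proof -
  have "poly c (1 / x) = (\<Sum>k\<le>n. coeff c k * (1 / x) ^ k)"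
    using assms(1) by (simp add: poly_eq_sum_upto)
  then show ?thesis
    using assms(2) unfolding J_def poly_sum poly_monom sum_distrib_left
    by (simp add: sum_distrib_left) (intro sum.cong, auto simp: power_diff power_one_over)
qed

lemma degree_J: "degree (J n c) \<le> n"
  unfolding J_def by (intro degree_sum_le) (auto intro: order.trans[OF degree_monom_le])

lemma poly_gf_is_poly:
  fixes f :: "complex poly"
  assumes "degree f \<le> n"
  shows "\<exists>q. degree q \<le> n \<and>
    fps_of_poly q = (1 - fps_X) ^ (n + 1) * Abs_fps (\<lambda>m. poly f (of_nat m))"
  using assms
proof (induction n arbitrary: f)
  case 0
  then obtain a where f: "f = [:a:]"
    by (metis degree_eq_zeroE le_zero_eq)
  have "(1 - fps_X) * Abs_fps (\<lambda>m. a) = fps_const a"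
    by (rule fps_ext) (auto simp: algebra_simps fps_X_mult_nth)
  then show ?case
    by (intro exI[of _ "[:a:]"]) (simp add: f fps_of_poly_const)
next
  case (Suc n)
  define g where "g = pcompose f [:1, 1:] - f"
  have "coeff g (Suc n) = 0" if "degree f = Suc n"
  proof -
    have "lead_coeff (pcompose f [:1,1:]) = lead_coeff f"
      by (subst lead_coeff_comp) auto
    then show ?thesis using that by (simp add: g_def degree_pcompose)
  qed
  moreover have "coeff g (Suc n) = 0" if "degree f < Suc n"
    using that by (simp add: g_def coeff_eq_0 degree_pcompose)
  ultimately have top: "coeff g (Suc n) = 0"
    using Suc.prems by linarith
  have "degree g \<le> Suc n"
    using Suc.prems unfolding g_def by (intro degree_diff_le) (auto simp: degree_pcompose)
  then have "degree g \<le> n"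
    using top by (metis le_SucE leading_coeff_0_iff degree_0 le0)
  from Suc.IH[OF this] obtain q where q: "degree q \<le> n"
    "fps_of_poly q = (1 - fps_X) ^ (n + 1) * Abs_fps (\<lambda>m. poly g (of_nat m))" by blast
  let ?r = "smult (poly f 0) ([:1, -1:] ^ (n + 1)) + [:0, 1:] * q"
  have step: "(1 - fps_X) * Abs_fps (\<lambda>m. poly f (of_nat m)) =
      fps_const (poly f 0) + fps_X * Abs_fps (\<lambda>m. poly g (of_nat m))"
  proof (rule fps_ext)
    fix m
    show "((1 - fps_X) * Abs_fps (\<lambda>m. poly f (of_nat m))) $ m =
      (fps_const (poly f 0) + fps_X * Abs_fps (\<lambda>m. poly g (of_nat m))) $ m"
      by (cases m) (auto simp: left_diff_distrib g_def poly_pcompose algebra_simps)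
  qed
  have lin: "fps_of_poly [:1, -1::complex:] = 1 - fps_X"
    by (simp add: fps_of_poly_pCons flip: fps_const_neg)
  have X: "fps_of_poly [:0, 1::complex:] = fps_X"
    by (simp add: fps_of_poly_pCons)
  have "fps_of_poly ?r = fps_const (poly f 0) * (1 - fps_X) ^ (n + 1) + fps_X * fps_of_poly q"
    unfolding fps_of_poly_add fps_of_poly_smult fps_of_poly_mult fps_of_poly_power lin X ..
  also have "\<dots> = (1 - fps_X) ^ (n + 1) *
      (fps_const (poly f 0) + fps_X * Abs_fps (\<lambda>m. poly g (of_nat m)))"
    unfolding q(2) by (simp only: algebra_simps)
  also have "\<dots> = (1 - fps_X) ^ (Suc n + 1) * Abs_fps (\<lambda>m. poly f (of_nat m))"
    unfolding step[symmetric] by (simp only: power_Suc add_Suc mult_ac)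
  finally have eq: "fps_of_poly ?r =
      (1 - fps_X) ^ (Suc n + 1) * Abs_fps (\<lambda>m. poly f (of_nat m))" .
  have "degree ([:1, -1::complex:] ^ (n + 1)) \<le> Suc n"
    by (rule order.trans[OF degree_power_le]) simp
  moreover have "degree ([:0, 1:] * q) \<le> Suc n"
    by (rule order.trans[OF degree_mult_le]) (use q(1) in simp)
  ultimately have "degree ?r \<le> Suc n"
    by (intro degree_add_le) (auto intro: order.trans[OF degree_smult_le])
  with eq show ?case by blast
qed

lemma U_mono_aux:
  assumes "p \<le> n"
  shows "fps_of_poly (U_mono n p) = U_series n p \<and> degree (U_mono n p) \<le> n"
proof -
  have "degree (monom (1::complex) p) \<le> n"
    using assms by (simp add: degree_monom_eq)
  from poly_gf_is_poly[OF this] obtain q where q: "degree q \<le> n"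
    "fps_of_poly q = (1 - fps_X) ^ (n + 1) * Abs_fps (\<lambda>m. of_nat m ^ p :: complex)"
    by (auto simp: poly_monom)
  let ?q = "smult (1 / fact n) q"
  have *: "fps_of_poly ?q = U_series n p"
    unfolding fps_of_poly_smult q(2) U_series_def by (simp only: mult_ac)
  have "U_mono n p = ?q"
    unfolding U_mono_def using * by (intro the_equality) (auto simp flip: fps_of_poly_eq_iff)
  then show ?thesis using * q(1) by simp
qed

lemma fps_of_poly_U_mono: "p \<le> n \<Longrightarrow> fps_of_poly (U_mono n p) = U_series n p"
  and degree_U_mono: "p \<le> n \<Longrightarrow> degree (U_mono n p) \<le> n"
  using U_mono_aux by blast+

lemma U_monom: "p \<le> n \<Longrightarrow> U n (monom 1 p) = U_mono n p"
proof -
  assume "p \<le> n"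
  have "U n (monom 1 p) = (\<Sum>k\<le>n. if k = p then U_mono n p else 0)"
    unfolding U_def by (rule sum.cong) auto
  then show ?thesis using \<open>p \<le> n\<close> by simp
qed

lemma degree_U: "degree (U n c) \<le> n"
  unfolding U_def
  by (intro degree_sum_le) (auto intro: order.trans[OF degree_smult_le] degree_U_mono)

lemma U_add: "U n (c + d) = U n c + U n d"
  and U_smult: "U n (smult a c) = smult a (U n c)"
proof -
  have smult_sum: "smult a (sum f A) = (\<Sum>i\<in>A. smult a (f i))" for f :: "nat \<Rightarrow> complex poly" and A
    by (induction A rule: infinite_finite_induct) (simp_all add: smult_add_right)
  show "U n (c + d) = U n c + U n d" "U n (smult a c) = smult a (U n c)"
    by (simp_all add: U_def smult_add_left sum.distrib smult_sum)
qed

lemma U_sum: "U n (\<Sum>i\<in>A. f i) = (\<Sum>i\<in>A. U n (f i))"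
proof (cases "finite A")
  case True
  then show ?thesis by induction (simp_all add: U_add, simp_all add: U_def)
qed (simp add: U_def)

lemma fps_of_poly_U:
  assumes "degree c \<le> n"
  shows "fps_of_poly (U n c) =
    fps_const (1 / fact n) * (1 - fps_X) ^ (n + 1) * Abs_fps (\<lambda>m. poly c (of_nat m))"
proof -
  have "Abs_fps (\<lambda>m. poly c (of_nat m)) =
      (\<Sum>p\<le>n. fps_const (coeff c p) * Abs_fps (\<lambda>m. of_nat m ^ p))"
    using assms by (intro fps_ext) (simp add: fps_sum_nth poly_eq_sum_upto)
  then have "fps_const (1 / fact n) * (1 - fps_X) ^ (n + 1) *
      Abs_fps (\<lambda>m. poly c (of_nat m)) = (\<Sum>p\<le>n. fps_const (coeff c p) * U_series n p)"
    unfolding U_series_def by (simp only: sum_distrib_left mult_ac)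
  also have "\<dots> = (\<Sum>p\<le>n. fps_const (coeff c p) * fps_of_poly (U_mono n p))"
    by (intro sum.cong) (auto simp: fps_of_poly_U_mono)
  also have "\<dots> = fps_of_poly (U n c)"
    unfolding U_def fps_of_poly_sum fps_of_poly_smult ..
  finally show ?thesis by simp
qed

text \<open>\<open>U_inv_mono n p\<close> is \<open>(x)\<^sub>p [x + 1]\<^bsub>n - p\<^esub>\<close>.\<close>

definition U_inv_mono :: "nat \<Rightarrow> nat \<Rightarrow> complex poly" where
  "U_inv_mono n p =
     (\<Prod>i=0..<p. [:- of_nat i, 1:]) * (\<Prod>i=0..<n - p. [:1 + of_nat i, 1:])"

lemma degree_U_inv_mono:
  assumes "p \<le> n"
  shows "degree (U_inv_mono n p) \<le> n"
proof -
  have 1: "degree (\<Prod>i=0..<p. [:- of_nat i, 1::complex:]) \<le> p"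
    by (rule order.trans[OF degree_prod_sum_le]) auto
  have 2: "degree (\<Prod>i=0..<n - p. [:1 + of_nat i, 1::complex:]) \<le> n - p"
    by (rule order.trans[OF degree_prod_sum_le]) auto
  show ?thesis
    unfolding U_inv_mono_def using 1 2 assms
    by (intro order.trans[OF degree_mult_le]) linarith
qed

lemma poly_U_inv_mono:
  assumes "p \<le> n"
  shows "poly (U_inv_mono n p) (of_nat m) =
    (if m < p then 0 else fact n * of_nat ((m - p + n) choose n))"
proof -
  have eq: "poly (U_inv_mono n p) (of_nat m) =
      fact p * of_nat (m choose p) * pochhammer (1 + of_nat m) (n - p)"
    unfolding U_inv_mono_def
    by (simp add: poly_prod binomial_gbinomial gbinomial_prod_rev pochhammer_prod algebra_simps)
  show ?thesis
  proof (cases "m < p")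
    case False
    then obtain k where k: "m = k + p" by (metis le_add_diff_inverse2 not_less)
    have "fact (m + (n - p)) = (fact m * pochhammer (1 + of_nat m) (n - p) :: complex)"
      using pochhammer_product[of m "m + (n - p)" "1::complex"] by (simp add: pochhammer_fact)
    then have f1: "pochhammer (1 + of_nat m) (n - p) = (fact (k + n) / fact m :: complex)"
      using k assms by (simp add: field_simps)
    have f2: "fact p * of_nat (m choose p) = (fact m / fact k :: complex)"
      using k by (simp add: binomial_fact)
    have f3: "fact n * of_nat ((m - p + n) choose n) = (fact (k + n) / fact k :: complex)"
      using k by (simp add: binomial_fact)
    show ?thesis unfolding eq using False unfolding f1 f2 f3 by simp
  qed (simp add: eq binomial_eq_0)
qed

lemma gf_binomial:
  "(1 - fps_X) ^ (n + 1) * Abs_fps (\<lambda>m. of_nat ((m + n) choose n)) = (1 :: complex fps)"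
proof (induction n)
  case 0
  show ?case by (rule fps_ext) (auto simp: left_diff_distrib)
next
  case (Suc n)
  have "(1 - fps_X) * Abs_fps (\<lambda>m. of_nat ((m + Suc n) choose Suc n)) =
      (Abs_fps (\<lambda>m. of_nat ((m + n) choose n)) :: complex fps)"
  proof (rule fps_ext)
    fix m
    show "((1 - fps_X) * Abs_fps (\<lambda>m. of_nat ((m + Suc n) choose Suc n))) $ m =
      (Abs_fps (\<lambda>m. of_nat ((m + n) choose n)) :: complex fps) $ m"
      by (cases m) (auto simp: left_diff_distrib)
  qed
  moreover have "(1 - fps_X) ^ (Suc n + 1) * F = (1 - fps_X) ^ (n + 1) * ((1 - fps_X) * F)"
    for F :: "complex fps"
    by (simp only: power_Suc add_Suc mult_ac)
  ultimately show ?case using Suc by (simp only:)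
qed

lemma U_U_inv_mono:
  assumes "p \<le> n"
  shows "U n (U_inv_mono n p) = monom 1 p"
proof -
  have "Abs_fps (\<lambda>m. poly (U_inv_mono n p) (of_nat m)) =
      fps_const (fact n) * (fps_X ^ p * Abs_fps (\<lambda>m. of_nat ((m + n) choose n)))"
    by (rule fps_ext) (simp add: poly_U_inv_mono[OF assms] fps_X_power_mult_nth)
  then have "fps_of_poly (U n (U_inv_mono n p)) = (fps_const (1 / fact n) * fps_const (fact n)) *
      fps_X ^ p * ((1 - fps_X) ^ (n + 1) * Abs_fps (\<lambda>m. of_nat ((m + n) choose n)))"
    unfolding fps_of_poly_U[OF degree_U_inv_mono[OF assms]] by (simp only: mult_ac)
  also have "\<dots> = fps_X ^ p"
    unfolding gf_binomial by simp
  also have "\<dots> = fps_of_poly (monom 1 p)"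
    by (simp add: fps_of_poly_monom)
  finally show ?thesis by (simp only: fps_of_poly_eq_iff)
qed

lemma bij_betw_U: "bij_betw (U n) (polys_upto n) (polys_upto n)"
proof (rule bij_betw_imageI)
  show "inj_on (U n) (polys_upto n)"
  proof (rule inj_onI)
    fix c d assume cd: "c \<in> polys_upto n" "d \<in> polys_upto n" "U n c = U n d"
    have "(1 - fps_X :: complex fps) \<noteq> 0"
    proof
      assume "(1 - fps_X :: complex fps) = 0"
      then have "(1 - fps_X :: complex fps) $ 0 = 0" by simp
      then show False by simp
    qed
    then have nz: "fps_const (1 / fact n :: complex) * (1 - fps_X) ^ (n + 1) \<noteq> 0"
      by simp
    have "Abs_fps (\<lambda>m. poly c (of_nat m)) = Abs_fps (\<lambda>m. poly d (of_nat m))"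
      using cd fps_of_poly_U[of c n] fps_of_poly_U[of d n] mult_left_cancel[OF nz] by simp
    then have eq: "poly c (of_nat m) = poly d (of_nat m)" for m
      by (metis fps_nth_Abs_fps)
    have "\<nat> \<subseteq> {x. poly (c - d) x = 0}"
      by (auto simp: Nats_def eq)
    moreover have "infinite (\<nat> :: complex set)"
      unfolding Nats_def by (rule range_inj_infinite) (rule inj_of_nat)
    ultimately have "c - d = 0"
      using poly_roots_finite finite_subset by blast
    then show "c = d" by simp
  qed
  show "U n ` polys_upto n = polys_upto n"
  proof
    show "U n ` polys_upto n \<subseteq> polys_upto n" by (auto simp: degree_U)
    show "polys_upto n \<subseteq> U n ` polys_upto n"
    proof
      fix q assume q: "q \<in> polys_upto n"
      let ?c = "\<Sum>p\<le>n. smult (coeff q p) (U_inv_mono n p)"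
      have "U n ?c = (\<Sum>p\<le>n. smult (coeff q p) (monom 1 p))"
        unfolding U_sum by (intro sum.cong) (auto simp: U_smult U_U_inv_mono)
      also have "\<dots> = q"
        using q by (simp add: smult_monom poly_as_sum_of_monoms')
      finally have "U n ?c = q" .
      moreover have "degree ?c \<le> n"
        by (intro degree_sum_le) (auto intro: order.trans[OF degree_smult_le] degree_U_inv_mono)
      ultimately show "q \<in> U n ` polys_upto n" by force
    qed
  qed
qed

lemma U_inv_monom:
  assumes "p \<le> n"
  shows "U_inv n (monom 1 p) = U_inv_mono n p"
  unfolding U_inv_def U_U_inv_mono[OF assms, symmetric]
  using bij_betw_U[of n] degree_U_inv_mono[OF assms]
  by (intro inv_into_f_f) (auto simp: bij_betw_def)

lemma degree_G: "degree (G n \<beta> c) \<le> n"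
  by (simp add: G_def degree_U)

end

theory Submission
  imports Defs
begin

text \<open>
  The involution \<open>d(x) \<mapsto> (-1)\<^sup>n d(-1 - x)\<close> sends \<open>(x)\<^sub>p [x + 1]\<^bsub>n - p\<^esub>\<close> to
  \<open>(x)\<^bsub>n - p\<^esub> [x + 1]\<^sub>p\<close>, so \<open>U n\<close> conjugates it into \<open>J n\<close>.  It also conjugates the
  shift by \<open>\<gamma>\<close> into the shift by \<open>-\<gamma>\<close>.
\<close>

definition negate_reflect :: "nat \<Rightarrow> complex poly \<Rightarrow> complex poly" where
  "negate_reflect n d = smult ((-1) ^ n) (pcompose d [:-1, -1:])"

lemma poly_negate_reflect: "poly (negate_reflect n d) x = (-1) ^ n * poly d (- 1 - x)"
  by (simp add: negate_reflect_def poly_pcompose)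

lemma degree_negate_reflect: "degree (negate_reflect n d) = degree d"
  by (simp add: negate_reflect_def degree_pcompose)

lemma degree_shift: "degree (shift \<gamma> d) = degree d"
  by (simp add: shift_def degree_pcompose)

text \<open>Under \<open>x\<close> to \<open>-1 - x\<close>, a factor \<open>x - i\<close> becomes
  \<open>-(x + 1 + i)\<close> and a factor \<open>x + 1 + i\<close> becomes \<open>-(x - i)\<close>.
  Falling and rising factors trade places.\<close>

lemma negate_reflect_U_inv_mono:
  assumes "p \<le> n"
  shows "negate_reflect n (U_inv_mono n p) = U_inv_mono n (n - p)"
proof -
  have "poly (negate_reflect n (U_inv_mono n p)) x = poly (U_inv_mono n (n - p)) x" for x
  proof -
    have falling: "(\<Prod>i=0..<p. - 1 - x - of_nat i) = (-1) ^ p * (\<Prod>i=0..<p. 1 + of_nat i + x)"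
      using prod_uminus[of "\<lambda>i. 1 + of_nat i + x" "{0..<p}"] by (simp add: algebra_simps)
    have rising: "(\<Prod>i=0..<n-p. of_nat i - x) = (-1) ^ (n - p) * (\<Prod>i=0..<n-p. x - of_nat i)"
      using prod_uminus[of "\<lambda>i. x - of_nat i" "{0..<n-p}"] by simp
    \<comment> \<open>Each of the \<open>n\<close> linear factors yields one sign; the prefactor in
      \<open>negate_reflect\<close> cancels them all.\<close>
    have sign: "(-1::complex) ^ n * ((-1) ^ p * (-1) ^ (n - p)) = 1"
      using assms by (simp flip: power_add power_mult_distrib)
    have "poly (negate_reflect n (U_inv_mono n p)) x =
        (-1) ^ n * ((\<Prod>i=0..<p. - 1 - x - of_nat i) * (\<Prod>i=0..<n-p. of_nat i - x))"
      by (simp add: poly_negate_reflect U_inv_mono_def poly_prod algebra_simps)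
    also have "\<dots> = ((-1) ^ n * ((-1) ^ p * (-1) ^ (n - p))) *
        ((\<Prod>i=0..<n-p. x - of_nat i) * (\<Prod>i=0..<p. 1 + of_nat i + x))"
      unfolding falling rising by (simp only: mult_ac)
    also have "\<dots> = poly (U_inv_mono n (n - p)) x"
      using assms unfolding sign by (simp add: U_inv_mono_def poly_prod algebra_simps)
    finally show ?thesis .
  qed
  then show ?thesis
    by (simp add: poly_eq_poly_eq_iff[symmetric] fun_eq_iff)
qed

lemma negate_reflect_sum_smult:
  "negate_reflect n (\<Sum>i\<in>A. smult (a i) (f i)) = (\<Sum>i\<in>A. smult (a i) (negate_reflect n (f i)))"
  by (simp add: poly_eq_poly_eq_iff[symmetric] fun_eq_iff poly_negate_reflect poly_sum
      sum_distrib_left mult_ac)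

text \<open>The two prefactors cancel, and the argument becomes
  \<open>-1 - (-1 - x + \<gamma>) = x - \<gamma>\<close>.\<close>

lemma negate_reflect_shift_negate_reflect:
  "negate_reflect n (shift \<gamma> (negate_reflect n d)) = shift (- \<gamma>) d"
  by (simp add: poly_eq_poly_eq_iff[symmetric] fun_eq_iff poly_negate_reflect shift_def
      poly_pcompose algebra_simps flip: power_mult_distrib)

lemma U_inv_U: "degree d \<le> n \<Longrightarrow> U_inv n (U n d) = d"
  using bij_betw_U[of n] unfolding U_inv_def by (intro inv_into_f_f) (auto simp: bij_betw_def)

lemma U_U_inv: "degree c \<le> n \<Longrightarrow> U n (U_inv n c) = c"
  and degree_U_inv: "degree c \<le> n \<Longrightarrow> degree (U_inv n c) \<le> n"
  using bij_betw_U[of n] inv_into_into[of c "U n" "polys_upto n"] unfolding U_inv_def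
  by (auto simp: bij_betw_def intro: f_inv_into_f)

text \<open>Makes the linearity of \<open>U_inv n\<close> explicit, which its definition by
  \<open>inv_into\<close> hides: the sum is a preimage of \<open>c\<close> of degree at most
  \<open>n\<close>, and such a preimage is unique.\<close>

lemma U_inv_expansion:
  assumes "degree c \<le> n"
  shows "U_inv n c = (\<Sum>p\<le>n. smult (coeff c p) (U_inv_mono n p))"
proof -
  let ?d = "\<Sum>p\<le>n. smult (coeff c p) (U_inv_mono n p)"
  have "U n ?d = c"
    using assms by (simp add: U_sum U_smult U_U_inv_mono smult_monom poly_as_sum_of_monoms')
  moreover have "degree ?d \<le> n"
    by (intro degree_sum_le) (auto intro: order.trans[OF degree_smult_le] degree_U_inv_mono)
  ultimately show ?thesis
    using U_inv_U by metis
qed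

text \<open>In the basis \<open>U_inv_mono n p\<close> the reflection exchanges the indices
  \<open>p\<close> and \<open>n - p\<close>, and \<open>U n\<close> turns this into the reversal of
  coefficients.\<close>

lemma U_negate_reflect_U_inv:
  assumes "degree c \<le> n"
  shows "U n (negate_reflect n (U_inv n c)) = J n c"
  by (simp add: U_inv_expansion[OF assms] negate_reflect_sum_smult negate_reflect_U_inv_mono
      U_sum U_smult U_U_inv_mono smult_monom J_def)

theorem theorem6p1:
  fixes n :: nat and \<beta> :: complex and c :: "complex poly"
  assumes "degree c \<le> n"
  shows "G n (- \<beta>) c = (J n \<circ> G n \<beta> \<circ> J n) c"
proof -
  let ?R = "negate_reflect n" and ?S = "shift (of_nat n * \<beta>)"
  have deg: "degree (U_inv n c) \<le> n"
    using assms by (rule degree_U_inv)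
  have "U_inv n (J n c) = ?R (U_inv n c)"
    unfolding U_negate_reflect_U_inv[OF assms, symmetric]
    by (rule U_inv_U) (simp add: degree_negate_reflect deg)
  then have "J n (G n \<beta> (J n c)) = J n (U n (?S (?R (U_inv n c))))"
    by (simp add: G_def)
  \<comment> \<open>The outer \<open>J n\<close> is conjugated in the same way, now at a value of
    \<open>U n\<close>, so the inner \<open>U_inv n\<close> cancels.\<close>
  also have "\<dots> = U n (?R (?S (?R (U_inv n c))))"
    by (simp add: U_negate_reflect_U_inv[symmetric] degree_U U_inv_U degree_shift
        degree_negate_reflect deg)
  also have "\<dots> = G n (- \<beta>) c"
    by (simp add: negate_reflect_shift_negate_reflect G_def)
  finally show ?thesis by simp
qed

end
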